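(* Let $K$ be a field, $S=K[x_1,\ldots,x_n]$, and let $\mathcal M=(\mu_{i,j})$ be a matrix of natural numbers with columns indexed by $i=1,\ldots,n$ and rows indexed by $j=1,2,3,\ldots$. Then $\mathcal M$ is the matrix of generators of a strongly stable monomial ideal $I\subset S$, provided that the following conditions hold: (1) Each nonzero row vector $(\mu_{1,j},\ldots,\mu_{n,j})$ of $\mathcal M$ is an $O$-sequence with $\mu_{2,j}\le j$. (2) For all $i\in\{1,\ldots,n\}$ and all $j$ one has $\mu_{i,j}\ge\sum_{q=1}^i\mu_{q,j-1}$. (3) If $m\in\mathbb N$ is the least number such that $\mu_{i,h}=\sum_{q=1}^i\mu_{q,h-1}$ for each $h>m$ and each $i\in\{1,\ldots,n\}$, then for each $j\le m$ there exists a strongly stable ideal $B(j)\subset S$ generated in degree $j$ such that $m_i(B(j))=\mu_{i,j}$ for all $i=1,\ldots,n$ and $B(j)\cap K[x_1,\ldots,x_{n-1}]_{j+1}$ is a piecewise lexsegment monomial space.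
   Context: A monomial ideal $I\subset S$ is strongly stable if for every monomial $u\in I$, every $j$ such that $x_j$ divides $u$, and every $i<j$, one has $(u/x_j)x_i\in I$. For a monomial $u\neq1$, $m(u)$ is the largest index $e$ such that $x_e$ divides $u$. For a strongly stable ideal $J$ with minimal set of monomial generators $G(J)$, $m_i(J)$ is the number of $u\in G(J)$ with $m(u)=i$. For an ideal $I$, $I_{\langle j\rangle}$ is the ideal generated by the degree-$j$ elements of $I$. The matrix of generators of a strongly stable ideal $I$ is the matrix $\mathcal M(I)=(\mu_{i,j}(I))$ with $\mu_{i,j}(I)=m_i(I_{\langle j\rangle})$, where $i=1,\ldots,n$ indexes columns and $j=1,2,3,\ldots$ indexes rows; by convention $\mu_{i,0}=0$. The zero ideal is regarded as generated in any degree. For a natural number $a$ and a positive integer $d$, with $d$-th Macaulay representation $a=\sum_{i=1}^d\binom{k(i)}{i}$, $k(d)>k(d-1)>\cdots>k(1)\ge0$ (which is unique), set $a^{\langle d\rangle}=\sum_{i=1}^d\binom{k(i)+1}{i+1}$. A vector $(m_1,\ldots,m_n)$ of natural numbers is an $O$-sequence if $m_1=1$ and $m_{i+1}\le m_i^{\langle i-1\rangle}$ for all $i=2,\ldots,n-1$. Monomials of the same degree are compared by the lexicographic order with $x_1>\cdots>x_n$. A space spanned by monomials of degree $d$ in $K[x_1,\ldots,x_r]$ is a piecewise lexsegment monomial space if, for each $i=1,\ldots,r$, the monomials $u$ in it with $m(u)=i$ are the lexicographically biggest ones (in whatever number there are) among all degree-$d$ monomials $u$ with $m(u)=i$. $K[x_1,\ldots,x_{n-1}]_{j+1}$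 is the degree-$(j+1)$ component of $K[x_1,\ldots,x_{n-1}]$. *)

theory Defs
  imports HOL.Modules "HOL-Library.Poly_Mapping" "HOL-Algebra.Ideal"
begin

text \<open>
  A monomial is identified with its exponent vector, a finitely supported function
  \<open>nat \<Rightarrow>\<^sub>0 nat\<close> (the value at \<open>i\<close> is the exponent of the variable \<open>x\<^sub>i\<close>), and a polynomial is a
  finitely supported function from exponent vectors to coefficients; the product provided by
  \<open>HOL-Library.Poly_Mapping\<close> is then the usual (convolution) product of polynomials.
\<close>

type_synonym expo = "nat \<Rightarrow>\<^sub>0 nat"
type_synonym 'k mpoly = "expo \<Rightarrow>\<^sub>0 'k"

definition monomials :: "nat \<Rightarrow> expo set" where
  "monomials r = {u. Poly_Mapping.keys u \<subseteq> {1..r}}"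

definition mdeg :: "expo \<Rightarrow> nat" where
  "mdeg u = (\<Sum>i\<in>Poly_Mapping.keys u. Poly_Mapping.lookup u i)"

definition mon :: "expo \<Rightarrow> 'k::field mpoly" where
  "mon u = Poly_Mapping.single u 1"

text \<open>The ring \<open>K[x\<^sub>1,\<dots>,x\<^sub>r]\<close>.\<close>

definition poly_ring :: "nat \<Rightarrow> 'k::field mpoly ring" where
  "poly_ring r =
     \<lparr>carrier = {f. Poly_Mapping.keys f \<subseteq> monomials r},
      monoid.mult = (*), one = 1, zero = 0, add = (+)\<rparr>"

lemma cring_poly_ring: "cring (poly_ring r :: 'k::field mpoly ring)"
proof -
  have add: "Poly_Mapping.keys (x + y) \<subseteq> monomials r"
    if "Poly_Mapping.keys x \<subseteq> monomials r" "Poly_Mapping.keys y \<subseteq> monomials r"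
    for x y :: "'k mpoly"
    using Poly_Mapping.keys_add[of x y] that by blast
  have mult: "Poly_Mapping.keys (x * y) \<subseteq> monomials r"
    if "Poly_Mapping.keys x \<subseteq> monomials r" "Poly_Mapping.keys y \<subseteq> monomials r"
    for x y :: "'k mpoly"
  proof -
    have "u + v \<in> monomials r" if "u \<in> monomials r" "v \<in> monomials r" for u v
      using that Poly_Mapping.keys_add[of u v] unfolding monomials_def by blast
    then show ?thesis using keys_mult[of x y] that by blast
  qed
  have one: "Poly_Mapping.keys (1 :: 'k mpoly) \<subseteq> monomials r"
    by (simp add: monomials_def)
  have inv: "\<exists>y. Poly_Mapping.keys y \<subseteq> monomials r \<and> x + y = 0"
    if "Poly_Mapping.keys x \<subseteq> monomials r" for x :: "'k mpoly"
    using that by (intro exI[of _ "- x"]) simp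
  show ?thesis
  proof (rule cringI)
    show "abelian_group (poly_ring r :: 'k mpoly ring)"
      by (rule abelian_groupI) (simp_all add: poly_ring_def add inv add.assoc add.commute)
    show "comm_monoid (poly_ring r :: 'k mpoly ring)"
      by (rule comm_monoidI) (simp_all add: poly_ring_def mult one[simplified] mult.assoc mult.commute)
  qed (simp add: poly_ring_def distrib_right)
qed

definition graded_component :: "nat \<Rightarrow> nat \<Rightarrow> 'k::field mpoly set" where
  "graded_component r d =
     {f \<in> carrier (poly_ring r). \<forall>u\<in>Poly_Mapping.keys f. mdeg u = d}"

definition monomial_ideal :: "nat \<Rightarrow> 'k::field mpoly set \<Rightarrow> bool" where
  "monomial_ideal n I \<longleftrightarrow>
     ideal I (poly_ring n) \<and>
     (\<exists>X. X \<subseteq> monomials n \<and> I = genideal (poly_ring n) (mon ` X))"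

text \<open>Below, \<open>Poly_Mapping.single i 1\<close> is the exponent vector of \<open>x\<^sub>i\<close>, so the last exponent
  vector is that of \<open>(u/x\<^sub>j)x\<^sub>i\<close>.\<close>

definition strongly_stable :: "nat \<Rightarrow> 'k::field mpoly set \<Rightarrow> bool" where
  "strongly_stable n I \<longleftrightarrow>
     monomial_ideal n I \<and>
     (\<forall>u\<in>monomials n. mon u \<in> I \<longrightarrow>
        (\<forall>j\<in>Poly_Mapping.keys u. \<forall>i. 1 \<le> i \<and> i < j \<longrightarrow>
           mon (u - Poly_Mapping.single j 1 + Poly_Mapping.single i 1) \<in> I))"

definition max_var :: "expo \<Rightarrow> nat" where
  "max_var u = Max (Poly_Mapping.keys u)"

text \<open>\<open>G(J)\<close> for a monomial ideal \<open>J\<close>; the zero ideal has \<open>G(J) = {}\<close>.\<close>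

definition min_gens :: "nat \<Rightarrow> 'k::field mpoly set \<Rightarrow> expo set" where
  "min_gens n J =
     (THE G. G \<subseteq> monomials n \<and> J = genideal (poly_ring n) (mon ` G) \<and>
             (\<forall>H. H \<subset> G \<longrightarrow> J \<noteq> genideal (poly_ring n) (mon ` H)))"

definition num_gens :: "nat \<Rightarrow> 'k::field mpoly set \<Rightarrow> nat \<Rightarrow> nat" where
  "num_gens n J i = card {u \<in> min_gens n J. u \<noteq> 0 \<and> max_var u = i}"

text \<open>\<open>I\<^bsub>\<langle>j\<rangle>\<^esub>\<close>\<close>

definition degree_part_ideal :: "nat \<Rightarrow> 'k::field mpoly set \<Rightarrow> nat \<Rightarrow> 'k mpoly set" where
  "degree_part_ideal n I j = genideal (poly_ring n) (I \<inter> graded_component n j)"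

text \<open>The entry \<open>\<mu>\<^bsub>i,j\<^esub>(I)\<close> in column \<open>i\<close> and row \<open>j\<close> of the matrix of generators.\<close>

definition gen_matrix :: "nat \<Rightarrow> 'k::field mpoly set \<Rightarrow> nat \<Rightarrow> nat \<Rightarrow> nat" where
  "gen_matrix n I i j = num_gens n (degree_part_ideal n I j) i"

text \<open>The zero ideal is generated in every degree (take \<open>X = {}\<close>).\<close>

definition generated_in_degree :: "nat \<Rightarrow> nat \<Rightarrow> 'k::field mpoly set \<Rightarrow> bool" where
  "generated_in_degree n j I \<longleftrightarrow>
     (\<exists>X. X \<subseteq> graded_component n j \<and> I = genideal (poly_ring n) X)"

definition macaulay_rep :: "nat \<Rightarrow> nat \<Rightarrow> (nat \<Rightarrow> nat) \<Rightarrow> bool" where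
  "macaulay_rep d a k \<longleftrightarrow>
     strict_mono_on {1..d} k \<and> a = (\<Sum>i=1..d. k i choose i)"

text \<open>\<open>a\<^bsup>\<langle>d\<rangle>\<^esup>\<close>, for \<open>d \<ge> 1\<close>\<close>

definition macaulay_up :: "nat \<Rightarrow> nat \<Rightarrow> nat" where
  "macaulay_up a d =
     (THE b. \<exists>k. macaulay_rep d a k \<and> b = (\<Sum>i=1..d. (k i + 1) choose (i + 1)))"

definition O_sequence :: "nat \<Rightarrow> (nat \<Rightarrow> nat) \<Rightarrow> bool" where
  "O_sequence n m \<longleftrightarrow>
     m 1 = 1 \<and> (\<forall>i\<in>{2..n - 1}. m (i + 1) \<le> macaulay_up (m i) (i - 1))"

definition monomial_span :: "expo set \<Rightarrow> 'k::field mpoly set" where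
  "monomial_span X = Modules.module.span (\<lambda>c f. Poly_Mapping.single 0 c * f) (mon ` X)"

text \<open>
  The order on exponent vectors from \<open>HOL-Library.Poly_Mapping\<close> compares the exponents at the
  smallest index where the vectors differ; on monomials of equal degree this is the
  lexicographic order with \<open>x\<^sub>1 > x\<^sub>2 > \<dots>\<close>.
\<close>

definition piecewise_lexsegment :: "nat \<Rightarrow> nat \<Rightarrow> 'k::field mpoly set \<Rightarrow> bool" where
  "piecewise_lexsegment r d V \<longleftrightarrow>
     (\<exists>X. X \<subseteq> {u \<in> monomials r. mdeg u = d} \<and> V = monomial_span X) \<and>
     (\<forall>i\<in>{1..r}. \<forall>u v.
        u \<in> monomials r \<and> mdeg u = d \<and> u \<noteq> 0 \<and> max_var u = i \<and>
        v \<in> monomials r \<and> mdeg v = d \<and> v \<noteq> 0 \<and> max_var v = i \<and>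
        mon v \<in> V \<and> v < u \<longrightarrow> mon u \<in> V)"

end

theory Submission
  imports Defs
begin

text \<open>
  The ideal is built degree by degree from the sets \<open>A\<^sub>j\<close> of its monomials of degree \<open>j\<close>. Such a sequence
  comes from a strongly stable ideal if each \<open>A\<^sub>j\<close> is closed under the exchanges \<open>u \<mapsto> (u/x\<^sub>k)x\<^sub>i\<close> and \<open>A\<^bsub>j+1\<^esub>\<close>
  contains the shadow of \<open>A\<^sub>j\<close>, the set of its products with variables. The elements of \<open>A\<^sub>j\<close> are the minimal
  generators in row \<open>j\<close>, so the requirement is that \<open>A\<^sub>j\<close> has \<open>\<mu>\<^bsub>i,j\<^esub>\<close> monomials with last variable \<open>x\<^sub>i\<close>.

  First, the number \<open>m\<close> of the third condition exists, so that this condition applies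
  (\<open>eventually_recursive\<close>). For rows \<open>j\<close> beyond \<open>m\<close> the shadow itself has the required numbers, because
  a stable set with \<open>a\<^sub>q\<close> monomials of last variable \<open>x\<^sub>q\<close> has a shadow with \<open>a\<^sub>1 + \<dots> + a\<^sub>i\<close> monomials of last
  variable \<open>x\<^sub>i\<close> (\<open>card_layer_shadow\<close>).

  For rows up to \<open>m\<close>, the ideals \<open>B(j)\<close> have the right numbers but need not contain each other. The
  piecewise lexsegment condition in degree \<open>j + 1\<close> says that the generators of \<open>B(j)\<close> in
  \<open>K[x\<^sub>1,\<dots>,x\<^bsub>n-1\<^esub>]\<close> form a lexsegment (\<open>generators_of_stable_ideal\<close>). Since the same holds for
  the part of \<open>A\<^sub>j\<close> free of \<open>x\<^sub>n\<close>, its shadow and \<open>B(j+1)\<close> can be compared on the monomials with a given last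
  variable \<open>x\<^sub>i\<close>, \<open>i < n\<close>: both contain the largest ones, and by the second condition \<open>B(j+1)\<close> contains
  at least as many. So \<open>B(j+1)\<close> contains the part of the shadow free of \<open>x\<^sub>n\<close>. The monomials divisible by \<open>x\<^sub>n\<close> are corrected separately: starting from the shadow of \<open>A\<^sub>j\<close> and the
  part of \<open>B(j+1)\<close> free of \<open>x\<^sub>n\<close>, monomials from \<open>B(j+1)\<close> are added in decreasing lexicographic order, which
  preserves stability, until there are \<open>\<mu>\<^bsub>n,j+1\<^esub>\<close> of them (\<open>extension_step\<close>).
\<close>

section \<open>O-sequences and the growth of Macaulay representations\<close>

text \<open>
  Comparing leading terms in this bound gives the uniqueness of Macaulay representations, which
  makes the description in \<^const>\<open>macaulay_up\<close> well defined.
\<close>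

lemma cascade_less:
  fixes k :: "nat \<Rightarrow> nat"
  assumes "strict_mono_on {1..Suc d} k"
  shows "(\<Sum>i=1..Suc d. k i choose i) < Suc (k (Suc d)) choose Suc d"
  using assms
proof (induction d)
  case 0
  then show ?case by simp
next
  case (Suc d)
  have "strict_mono_on {1..Suc d} k"
    using Suc.prems by (rule monotone_on_subset) auto
  then have "(\<Sum>i=1..Suc d. k i choose i) < Suc (k (Suc d)) choose Suc d"
    by (rule Suc.IH)
  also have "\<dots> \<le> k (Suc (Suc d)) choose Suc d"
    using strict_mono_onD[OF Suc.prems, of "Suc d" "Suc (Suc d)"]
    by (intro binomial_right_mono) simp
  finally show ?case by simp
qed

lemma macaulay_rep_unique:
  assumes "macaulay_rep d a k" "macaulay_rep d a k'" "i \<in> {1..d}"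
  shows "k i = k' i"
  using assms
proof (induction d arbitrary: a i)
  case 0
  then show ?case by simp
next
  case (Suc d)
  have top: "\<not> l (Suc d) < l' (Suc d)"
    if "macaulay_rep (Suc d) a l" "macaulay_rep (Suc d) a l'" for l l' :: "nat \<Rightarrow> nat"
  proof
    assume "l (Suc d) < l' (Suc d)"
    then have "Suc (l (Suc d)) choose Suc d \<le> l' (Suc d) choose Suc d"
      by (intro binomial_right_mono) simp
    with cascade_less[of d l] that show False
      unfolding macaulay_rep_def by auto
  qed
  then have eq: "k (Suc d) = k' (Suc d)"
    using Suc.prems(1,2) by (meson linorder_neqE_nat)
  have "macaulay_rep d (a - (k (Suc d) choose Suc d)) l"
    if "macaulay_rep (Suc d) a l" "l (Suc d) = k (Suc d)" for l :: "nat \<Rightarrow> nat"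
    using that monotone_on_subset[of "{1..Suc d}" "(<)" "(<)" l "{1..d}"]
    unfolding macaulay_rep_def by auto
  then have "j \<in> {1..d} \<Longrightarrow> k j = k' j" for j
    using Suc.IH Suc.prems(1,2) eq by metis
  then show ?case
    using eq Suc.prems(3) by (cases "i = Suc d") auto
qed

lemma macaulay_up_eq:
  assumes "macaulay_rep d a k"
  shows "macaulay_up a d = (\<Sum>i=1..d. (k i + 1) choose (i + 1))"
  unfolding macaulay_up_def
proof (rule the_equality)
  fix b
  assume "\<exists>k. macaulay_rep d a k \<and> b = (\<Sum>i=1..d. (k i + 1) choose (i + 1))"
  then show "b = (\<Sum>i=1..d. (k i + 1) choose (i + 1))"
    using macaulay_rep_unique[OF assms] by (auto intro!: sum.cong)
qed (use assms in blast)

text \<open>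
  From the index \<open>N\<close> on, the value \<open>f (N + j)\<close> has a \<open>d\<close>-th Macaulay representation whose entries
  \<open>c i + j\<close>, for \<open>p \<le> i \<le> d\<close>, all move up by one when \<open>j\<close> does. The entries below \<open>p\<close> are \<open>i - 1\<close>;
  they contribute nothing and are left out of the sum. For \<open>p > d\<close> the function is eventually zero.
\<close>

definition steady :: "nat \<Rightarrow> (nat \<Rightarrow> nat) \<Rightarrow> bool" where
  "steady d f \<longleftrightarrow> (\<exists>N p c. 1 \<le> p \<and> strict_mono_on {p..d} c \<and> (\<forall>i\<in>{p..d}. i \<le> c i) \<and>
     (\<forall>j. f (N + j) = (\<Sum>i=p..d. (c i + j) choose i)))"

text \<open>
  A sum of binomial coefficients that starts at an index \<open>p > 1\<close> is completed to a Macaulay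
  representation by the entries \<open>k i = i - 1\<close>, whose terms vanish before and after the shift.
\<close>

lemma macaulay_up_cascade:
  fixes c :: "nat \<Rightarrow> nat"
  assumes "1 \<le> p" "strict_mono_on {p..d} c" "\<forall>i\<in>{p..d}. i \<le> c i"
  shows "macaulay_up (\<Sum>i=p..d. c i choose i) d = (\<Sum>i=p..d. Suc (c i) choose Suc i)"
proof -
  define k where "k i = (if i < p then i - 1 else c i)" for i
  have "strict_mono_on {1..d} k"
  proof (rule strict_mono_onI)
    fix r s assume rs: "r \<in> {1..d}" "s \<in> {1..d}" "r < s"
    show "k r < k s"
    proof (cases "p \<le> r")
      case True
      then show ?thesis using rs strict_mono_onD[OF assms(2), of r s] by (simp add: k_def)
    next
      case False
      have "s \<le> c s" if "p \<le> s" using assms(3) rs that by simp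
      then show ?thesis using rs False by (auto simp: k_def)
    qed
  qed
  moreover have "(\<Sum>i=p..d. c i choose i) = (\<Sum>i=1..d. k i choose i)"
    using assms(1) by (intro sum.mono_neutral_cong_left) (auto simp: k_def)
  ultimately have "macaulay_rep d (\<Sum>i=p..d. c i choose i) k"
    unfolding macaulay_rep_def by simp
  from macaulay_up_eq[OF this] have "macaulay_up (\<Sum>i=p..d. c i choose i) d
      = (\<Sum>i=1..d. (k i + 1) choose (i + 1))" .
  also have "\<dots> = (\<Sum>i=p..d. Suc (c i) choose Suc i)"
    using assms(1) by (intro sum.mono_neutral_cong_right) (auto simp: k_def)
  finally show ?thesis .
qed

lemma decseq_nat_eventually_const:
  fixes D :: "nat \<Rightarrow> nat"
  assumes "\<And>j. D (Suc j) \<le> D j"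
  obtains s e where "\<And>j. s \<le> j \<Longrightarrow> D j = e"
proof -
  define e where "e = (LEAST x. x \<in> range D)"
  have "e \<in> range D" unfolding e_def by (rule LeastI[of _ "D 0"]) simp
  then obtain s where s: "D s = e" by auto
  have "D j = e" if "s \<le> j" for j
  proof (rule antisym)
    show "D j \<le> e" using lift_Suc_antimono_le[of D, OF assms that] s by simp
    show "e \<le> D j" unfolding e_def by (rule Least_le) simp
  qed
  then show ?thesis using that by blast
qed

text \<open>
  If \<open>f\<close> is steady, then \<open>F j = macaulay_up (f j) d\<close> satisfies \<open>F (j + 1) = F j + f (j + 1)\<close> for large
  \<open>j\<close>. So the deficiency of \<open>g\<close> below \<open>F\<close> cannot increase and becomes a constant \<open>e\<close>; from then on
  the growth of \<open>g\<close> is exactly that of \<open>F\<close>, and \<open>F - e\<close> is again steady.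
\<close>

lemma steady_step:
  assumes f: "steady d f"
    and up: "\<forall>\<^sub>F j in sequentially. g j \<le> macaulay_up (f j) d"
    and grow: "\<forall>\<^sub>F j in sequentially. g j + f (Suc j) \<le> g (Suc j)"
  shows "steady (Suc d) g" "\<forall>\<^sub>F j in sequentially. g (Suc j) = g j + f (Suc j)"
proof -
  obtain N0 p c0 where p: "1 \<le> p" and c0: "strict_mono_on {p..d} c0" "\<forall>i\<in>{p..d}. i \<le> c0 i"
    and f0: "\<And>j. f (N0 + j) = (\<Sum>i=p..d. (c0 i + j) choose i)"
    using f unfolding steady_def by blast
  obtain N1 where up1: "\<And>j. N1 \<le> j \<Longrightarrow> g j \<le> macaulay_up (f j) d"
    and grow1: "\<And>j. N1 \<le> j \<Longrightarrow> g j + f (Suc j) \<le> g (Suc j)"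
    using eventually_conj[OF up grow] unfolding eventually_sequentially by blast
  define N where "N = N0 + N1"
  define c where "c i = c0 i + N1" for i
  have c: "strict_mono_on {p..d} c" "\<forall>i\<in>{p..d}. i \<le> c i"
    using c0 unfolding c_def by (auto simp: strict_mono_on_def)
  have fN: "f (N + j) = (\<Sum>i=p..d. (c i + j) choose i)" for j
    using f0[of "N1 + j"] by (simp add: N_def c_def ac_simps)
  define F where "F j = (\<Sum>i=p..d. Suc (c i + j) choose Suc i)" for j
  have upF: "macaulay_up (f (N + j)) d = F j" for j
    unfolding fN F_def
    by (rule macaulay_up_cascade[where c="\<lambda>i. c i + j"])
      (use p c in \<open>auto simp: strict_mono_on_def trans_le_add1\<close>)
  have F_Suc: "F (Suc j) = F j + f (N + Suc j)" for j
    unfolding F_def fN by (simp add: sum.distrib)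
  have gF: "g (N + j) \<le> F j" for j
    using up1[of "N + j"] upF[of j] by (simp add: N_def)
  have gS: "g (N + j) + f (N + Suc j) \<le> g (N + Suc j)" for j
    using grow1[of "N + j"] by (simp add: N_def)
  define D where "D j = F j - g (N + j)" for j
  have "D (Suc j) \<le> D j" for j
    using F_Suc[of j] gS[of j] gF[of j] gF[of "Suc j"] unfolding D_def by linarith
  then obtain s0 e where D: "\<And>j. s0 \<le> j \<Longrightarrow> D j = e"
    using decseq_nat_eventually_const by blast
  have gFe: "g (N + j) + e = F j" if "s0 \<le> j" for j
    using D[OF that] gF[of j] unfolding D_def by simp
  show "\<forall>\<^sub>F j in sequentially. g (Suc j) = g j + f (Suc j)"
    unfolding eventually_sequentially
  proof (intro exI allI impI)
    fix j assume "N + s0 \<le> j"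
    then obtain i where "j = N + i" "s0 \<le> i" by (metis add_le_cancel_left le_iff_add add.assoc)
    then show "g (Suc j) = g j + f (Suc j)"
      using gFe[of i] gFe[of "Suc i"] F_Suc[of i] by simp
  qed
  \<comment> \<open>Far enough out for the deficiency to be constant and for the lowest entry to exceed it,
      so that \<open>e\<close> can be taken off the last term below.\<close>
  define s where "s = s0 + e + 1"
  have gs: "g (N + s + j) + e = F (s + j)" for j
    using gFe[of "s + j"] by (simp add: s_def ac_simps)
  show "steady (Suc d) g"
  proof (cases "e = 0")
    case True
    show ?thesis unfolding steady_def
    proof (intro exI conjI ballI allI)
      let ?c = "\<lambda>i. Suc (c (i - 1) + s)"
      show "strict_mono_on {Suc p..Suc d} ?c"
        using strict_mono_onD[OF c(1)] by (intro strict_mono_onI) auto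
      show "i \<le> ?c i" if "i \<in> {Suc p..Suc d}" for i
        using bspec[OF c(2), of "i - 1"] that by (cases i) auto
      have "F (s + j) = (\<Sum>i=Suc p..Suc d. (?c i + j) choose i)" for j
        unfolding sum.shift_bounds_cl_Suc_ivl F_def by (simp add: ac_simps)
      then show "g ((N + s) + j) = (\<Sum>i=Suc p..Suc d. (?c i + j) choose i)" for j
        using gs[of j] True by simp
    qed simp
  next
    case False
    have pd: "p \<le> d"
    proof (rule ccontr)
      assume "\<not> p \<le> d"
      then have "F (s + 0) = 0" by (simp add: F_def)
      with gs[of 0] False show False by simp
    qed
    \<comment> \<open>The lowest term \<open>(c p + s + j + 1) choose (p + 1)\<close> of \<open>F\<close> is expanded as the hockey-stick sum of
        \<open>(m + j + i) choose i\<close> over \<open>i \<le> p + 1\<close>; the constant term and \<open>- e\<close> are absorbed in the entry at \<open>i = 1\<close>.\<close>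
    define m where "m = c p + s - Suc p"
    have m: "m + Suc p = c p + s" and me: "e \<le> m"
      using bspec[OF c(2), of p] pd by (auto simp: m_def s_def)
    define c' where "c' i = (if i = 1 then m + 2 - e else if i \<le> Suc p then m + i else Suc (c (i - 1) + s))" for i
    show ?thesis unfolding steady_def
    proof (intro exI conjI ballI allI)
      show "strict_mono_on {1..Suc d} c'"
      proof (rule strict_mono_onI)
        fix a b assume ab: "a \<in> {1..Suc d}" "b \<in> {1..Suc d}" "a < b"
        have "c p < c (b - 1)" if "Suc p < b"
          using strict_mono_onD[OF c(1), of p "b - 1"] that ab pd by auto
        moreover have "c (a - 1) < c (b - 1)" if "Suc p < a"
          using strict_mono_onD[OF c(1), of "a - 1" "b - 1"] that ab pd by auto
        ultimately show "c' a < c' b"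
          using ab False m me p unfolding c'_def by auto
      qed
      show "i \<le> c' i" if "i \<in> {1..Suc d}" for i
        using bspec[OF c(2), of "i - 1"] that me unfolding c'_def by (cases i) auto
      fix j
      have hockey: "Suc (c p + (s + j)) choose Suc p = (\<Sum>i=2..Suc p. (c' i + j) choose i) + (m + j + 2)"
      proof -
        have "Suc (c p + (s + j)) choose Suc p = Suc ((m + j) + Suc p) choose Suc p"
          using m by (simp add: ac_simps)
        also have "\<dots> = (\<Sum>i\<le>Suc p. (m + j + i) choose i)"
          by (rule sum_choose_lower[symmetric])
        also have "{..Suc p} = {0, 1} \<union> {2..Suc p}" by auto
        also have "(\<Sum>i\<in>{0, 1} \<union> {2..Suc p}. (m + j + i) choose i) = (m + j + 2) + (\<Sum>i=2..Suc p. (m + j + i) choose i)"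
          by (subst sum.union_disjoint) auto
        also have "(\<Sum>i=2..Suc p. (m + j + i) choose i) = (\<Sum>i=2..Suc p. (c' i + j) choose i)"
          by (intro sum.cong) (auto simp: c'_def ac_simps)
        finally show ?thesis by simp
      qed
      have tail: "(\<Sum>i=Suc p..d. Suc (c i + (s + j)) choose Suc i) = (\<Sum>i=Suc (Suc p)..Suc d. (c' i + j) choose i)"
        unfolding sum.shift_bounds_cl_Suc_ivl by (intro sum.cong) (use p in \<open>auto simp: c'_def ac_simps\<close>)
      have "F (s + j) = (Suc (c p + (s + j)) choose Suc p) + (\<Sum>i=Suc p..d. Suc (c i + (s + j)) choose Suc i)"
        unfolding F_def using pd by (simp only: sum.atLeast_Suc_atMost)
      also have "\<dots> = ((\<Sum>i=2..Suc p. (c' i + j) choose i) + (\<Sum>i=Suc (Suc p)..Suc d. (c' i + j) choose i)) + (c' 1 + j) + e"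
        unfolding hockey tail using me by (simp add: c'_def)
      also have "(\<Sum>i=2..Suc p. (c' i + j) choose i) + (\<Sum>i=Suc (Suc p)..Suc d. (c' i + j) choose i) = (\<Sum>i=2..Suc d. (c' i + j) choose i)"
      proof -
        have "{2..Suc d} = {2..Suc p} \<union> {Suc (Suc p)..Suc d}" using p pd by auto
        then show ?thesis by (simp only:) (subst sum.union_disjoint, auto)
      qed
      also have "(\<Sum>i=2..Suc d. (c' i + j) choose i) + (c' 1 + j) = (\<Sum>i=1..Suc d. (c' i + j) choose i)"
        using sum.atLeast_Suc_atMost[of 1 "Suc d" "\<lambda>i. (c' i + j) choose i"]
        by (simp add: numeral_2_eq_2 del: sum.cl_ivl_Suc)
      finally show "g ((N + s) + j) = (\<Sum>i=1..Suc d. (c' i + j) choose i)"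
        using gs[of j] by simp
    qed simp
  qed
qed

text \<open>
  A matrix whose nonzero rows are O-sequences with \<open>\<mu> 2 j \<le> j\<close>, and whose rows grow at least as fast
  as those of an ideal, has only finitely many rows with new generators. The columns are treated
  from left to right: each is steady because it is squeezed between the growth forced by the
  previous columns and an upper bound, which is \<open>j\<close> for the second column and the Macaulay bound given
  by the previous column afterwards.
\<close>

lemma eventually_recursive:
  fixes \<mu> :: "nat \<Rightarrow> nat \<Rightarrow> nat"
  assumes cond1: "\<And>j. 1 \<le> j \<Longrightarrow> \<exists>i\<in>{1..n}. \<mu> i j \<noteq> 0 \<Longrightarrow>
                  O_sequence n (\<lambda>i. \<mu> i j) \<and> (2 \<le> n \<longrightarrow> \<mu> 2 j \<le> j)"
    and cond2: "\<And>i j. i \<in> {1..n} \<Longrightarrow> 1 \<le> j \<Longrightarrow> (\<Sum>q=1..i. \<mu> q (j - 1)) \<le> \<mu> i j"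
  shows "\<exists>m. \<forall>h>m. \<forall>i\<in>{1..n}. \<mu> i h = (\<Sum>q=1..i. \<mu> q (h - 1))"
proof (cases "\<exists>j\<ge>1. \<exists>i\<in>{1..n}. \<mu> i j \<noteq> 0")
  case False
  then have zero: "\<mu> i j = 0" if "1 \<le> j" "i \<in> {1..n}" for i j using that by blast
  show ?thesis
  proof (intro exI[of _ 1] allI impI ballI)
    fix h :: nat and i assume "1 < h" "i \<in> {1..n}"
    then show "\<mu> i h = (\<Sum>q=1..i. \<mu> q (h - 1))" by (simp add: zero)
  qed
next
  case True
  then obtain j0 i0 where j0: "1 \<le> j0" "i0 \<in> {1..n}" "\<mu> i0 j0 \<noteq> 0" by blast
  have grow: "(\<Sum>q=1..i. \<mu> q j) \<le> \<mu> i (Suc j)" if "i \<in> {1..n}" for i j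
    using cond2[OF that, of "Suc j"] by simp
  \<comment> \<open>A nonzero entry persists in its column, so all rows from \<open>j0\<close> on are O-sequences.\<close>
  have nz: "\<mu> i0 j \<noteq> 0" if "j0 \<le> j" for j
    using that
  proof (induction j rule: dec_induct)
    case (step j)
    have "\<mu> i0 j \<le> (\<Sum>q=1..i0. \<mu> q j)"
      using j0(2) by (intro member_le_sum) auto
    with grow[OF j0(2), of j] step.IH show ?case by simp
  qed (use j0 in simp)
  then have Oseq: "O_sequence n (\<lambda>i. \<mu> i j)" and mu2: "2 \<le> n \<Longrightarrow> \<mu> 2 j \<le> j" if "j0 \<le> j" for j
    using cond1[of j] bexI[of "\<lambda>i. \<mu> i j \<noteq> 0" i0] nz[OF that] j0(1,2) that by simp_all
  have mu1: "\<mu> 1 j = 1" if "j0 \<le> j" for j using Oseq[OF that] unfolding O_sequence_def by simp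
  let ?E = "\<lambda>i. \<forall>\<^sub>F j in sequentially. \<mu> i (Suc j) = (\<Sum>q=1..i. \<mu> q j)"
  have E1: "?E 1" unfolding eventually_sequentially
    by (rule exI[of _ j0]) (simp add: mu1[simplified])
  have start: "steady 1 (\<mu> 2) \<and> ?E 2" if n: "2 \<le> n"
  proof -
    define D where "D j = j0 + j - \<mu> 2 (j0 + j)" for j
    have g: "1 + \<mu> 2 j \<le> \<mu> 2 (Suc j)" if "j0 \<le> j" for j
      using grow[of 2 j] n mu1[OF that] by (simp add: numeral_2_eq_2)
    have "D (Suc j) \<le> D j" for j
      using g[of "j0 + j"] unfolding D_def by simp
    then obtain s e where D: "\<And>j. s \<le> j \<Longrightarrow> D j = e"
      using decseq_nat_eventually_const by blast
    have eq: "\<mu> 2 (j0 + j) + e = j0 + j" if "s \<le> j" for j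
      using D[OF that] mu2[of "j0 + j"] n by (simp add: D_def)
    have eq': "\<mu> 2 (j0 + Suc s + j) = \<mu> 2 (j0 + Suc s) + j" for j
      using eq[of "Suc s"] eq[of "Suc s + j"] by (simp add: ac_simps)
    have "1 \<le> \<mu> 2 (j0 + Suc s)" using g[of "j0 + s"] by simp
    then have "steady 1 (\<mu> 2)"
      unfolding steady_def using eq'
      by (intro exI[of _ "j0 + Suc s"] exI[of _ "1::nat"] exI[of _ "\<lambda>_. \<mu> 2 (j0 + Suc s)"])
        (simp add: strict_mono_on_def)
    moreover have "?E 2" unfolding eventually_sequentially
    proof (intro exI allI impI)
      fix j assume "j0 + s \<le> j"
      then obtain i where "j = j0 + i" "s \<le> i" by (metis add_le_cancel_left le_iff_add add.assoc)
      then show "\<mu> 2 (Suc j) = (\<Sum>q=1..2. \<mu> q j)"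
        using eq[of i] eq[of "Suc i"] mu1[of j] by (simp add: numeral_2_eq_2)
    qed
    ultimately show ?thesis by blast
  qed
  have main: "steady (i - 1) (\<mu> i) \<and> ?E i" if "2 \<le> i" "i \<le> n" for i
    using that
  proof (induction i rule: dec_induct)
    case base
    then show ?case using start by simp
  next
    case (step i)
    then have IH: "steady (i - 1) (\<mu> i)" "?E i" by auto
    have "\<forall>\<^sub>F j in sequentially. \<mu> (Suc i) j \<le> macaulay_up (\<mu> i j) (i - 1)"
      unfolding eventually_sequentially
      using Oseq step.hyps step.prems unfolding O_sequence_def
      by (intro exI[of _ j0]) auto
    moreover have gr: "\<forall>\<^sub>F j in sequentially. \<mu> (Suc i) j + \<mu> i (Suc j) \<le> \<mu> (Suc i) (Suc j)"
      using IH(2)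
    proof eventually_elim
      case (elim j)
      then show ?case using grow[of "Suc i" j] step by simp
    qed
    ultimately have st: "steady (Suc (i - 1)) (\<mu> (Suc i))"
      and "\<forall>\<^sub>F j in sequentially. \<mu> (Suc i) (Suc j) = \<mu> (Suc i) j + \<mu> i (Suc j)"
      using steady_step[OF IH(1)] by blast+
    from this(2) IH(2) have "?E (Suc i)"
      by eventually_elim simp
    with st step.hyps show ?case by simp
  qed
  have "\<forall>i\<in>{1..n}. ?E i"
  proof
    fix i assume "i \<in> {1..n}"
    then show "?E i" using main[of i] E1 by (cases "i = 1") auto
  qed
  then have "\<forall>\<^sub>F j in sequentially. \<forall>i\<in>{1..n}. \<mu> i (Suc j) = (\<Sum>q=1..i. \<mu> q j)"
    by (simp add: eventually_ball_finite)
  then obtain N where N: "\<And>j i. N \<le> j \<Longrightarrow> i \<in> {1..n} \<Longrightarrow> \<mu> i (Suc j) = (\<Sum>q=1..i. \<mu> q j)"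
    unfolding eventually_sequentially by blast
  show ?thesis
  proof (intro exI[of _ N] allI impI ballI)
    fix h i assume "N < h" "i \<in> {1..n}"
    then show "\<mu> i h = (\<Sum>q=1..i. \<mu> q (h - 1))" using N[of "h - 1" i] by simp
  qed
qed

section \<open>Exponent vectors and stable sets of monomials\<close>

text \<open>
  The exponent vector of the variable \<open>x\<^sub>i\<close>.
\<close>

definition var :: "nat \<Rightarrow> expo" where "var i = Poly_Mapping.single i 1"

text \<open>
  The monomials of degree \<open>d\<close> in the first \<open>r\<close> variables.
\<close>

definition degree_monomials :: "nat \<Rightarrow> nat \<Rightarrow> expo set" where
  "degree_monomials r d = {u \<in> monomials r. mdeg u = d}"

text \<open>
  The exchange condition of strong stability for a set of exponent vectors; the set is usually
  contained in a single degree.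
\<close>

definition stable_set :: "expo set \<Rightarrow> bool" where
  "stable_set A \<longleftrightarrow>
     (\<forall>u\<in>A. \<forall>j\<in>Poly_Mapping.keys u. \<forall>i. 1 \<le> i \<and> i < j \<longrightarrow> u - var j + var i \<in> A)"

text \<open>
  All products of a monomial in \<open>A\<close> with one of the variables \<open>x\<^sub>1, \<dots>, x\<^sub>n\<close>.
\<close>

definition shadow :: "nat \<Rightarrow> expo set \<Rightarrow> expo set" where
  "shadow n A = {u + var k |u k. u \<in> A \<and> k \<in> {1..n}}"

lemma stable_setD:
  "stable_set A \<Longrightarrow> u \<in> A \<Longrightarrow> j \<in> Poly_Mapping.keys u \<Longrightarrow> 1 \<le> i \<Longrightarrow> i < j \<Longrightarrow> u - var j + var i \<in> A"
  unfolding stable_set_def by blast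

lemma keys_add_expo: "Poly_Mapping.keys (u + v) = Poly_Mapping.keys u \<union> Poly_Mapping.keys (v :: expo)"
  by (auto simp: in_keys_iff lookup_add)

lemma keys_var [simp]: "Poly_Mapping.keys (var i) = {i}"
  by (simp add: var_def)

lemma lookup_var: "Poly_Mapping.lookup (var i) k = (if k = i then 1 else 0)"
  by (simp add: var_def lookup_single when_def)

lemma keys_move_subset: "Poly_Mapping.keys (u - var j + var i) \<subseteq> insert i (Poly_Mapping.keys u)"
  by (auto simp: in_keys_iff lookup_add lookup_minus lookup_var split: if_splits)

lemma minus_var_add_var: "j \<in> Poly_Mapping.keys u \<Longrightarrow> u - var j + var j = (u :: expo)"
  by (rule poly_mapping_eqI) (auto simp: in_keys_iff lookup_add lookup_minus lookup_var)

lemma mdeg_eq_sum: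
  assumes "finite S" "Poly_Mapping.keys u \<subseteq> S"
  shows "mdeg u = (\<Sum>i\<in>S. Poly_Mapping.lookup u i)"
  unfolding mdeg_def using assms by (intro sum.mono_neutral_left) (auto simp: in_keys_iff)

lemma mdeg_add: "mdeg (u + v) = mdeg u + mdeg v"
proof -
  let ?S = "Poly_Mapping.keys u \<union> Poly_Mapping.keys v"
  show ?thesis
    using mdeg_eq_sum[of ?S u] mdeg_eq_sum[of ?S v] mdeg_eq_sum[of ?S "u + v"]
    by (simp add: keys_add_expo lookup_add sum.distrib)
qed

lemma mdeg_var [simp]: "mdeg (var i) = 1"
  by (simp add: mdeg_def lookup_var)

lemma mdeg_eq_0_iff: "mdeg u = 0 \<longleftrightarrow> u = 0"
  unfolding mdeg_def by (metis finite_keys in_keys_iff keys_eq_empty ex_in_conv sum.empty sum_eq_0_iff)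

lemma mdeg_move: "j \<in> Poly_Mapping.keys u \<Longrightarrow> mdeg (u - var j + var i) = mdeg u"
  using mdeg_add[of "u - var j" "var i"] mdeg_add[of "u - var j" "var j"]
  by (simp add: minus_var_add_var)

lemma monomials_add_iff: "u + v \<in> monomials n \<longleftrightarrow> u \<in> monomials n \<and> v \<in> monomials n"
  by (auto simp: monomials_def keys_add_expo)

lemma var_in_monomials: "k \<in> {1..n} \<Longrightarrow> var k \<in> monomials n"
  by (simp add: monomials_def)

lemma monomials_move:
  assumes "u \<in> monomials n" "j \<in> Poly_Mapping.keys u" "1 \<le> i" "i < j"
  shows "u - var j + var i \<in> monomials n"
proof -
  have "insert i (Poly_Mapping.keys u) \<subseteq> {1..n}"
    using assms by (auto simp: monomials_def)
  with keys_move_subset[of u j i] show ?thesis by (auto simp: monomials_def)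
qed

lemma stable_degree_monomials: "stable_set (degree_monomials n d)"
  unfolding stable_set_def degree_monomials_def by (auto simp: monomials_move mdeg_move)

lemma stable_Un: "stable_set A \<Longrightarrow> stable_set B \<Longrightarrow> stable_set (A \<union> B)"
  unfolding stable_set_def by blast

lemma stable_Int: "stable_set A \<Longrightarrow> stable_set B \<Longrightarrow> stable_set (A \<inter> B)"
  unfolding stable_set_def by blast

lemma stable_monomials: "stable_set (monomials n)"
  unfolding stable_set_def by (auto simp: monomials_move)

lemma stable_shadow:
  assumes "stable_set A"
  shows "stable_set (shadow n A)"
  unfolding stable_set_def
proof (intro ballI allI impI)
  fix w j i assume w: "w \<in> shadow n A" and j: "j \<in> Poly_Mapping.keys w" and i: "1 \<le> i \<and> i < j"
  from w obtain u k where uk: "w = u + var k" "u \<in> A" "k \<in> {1..n}" unfolding shadow_def by blast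
  show "w - var j + var i \<in> shadow n A"
  proof (cases "j \<in> Poly_Mapping.keys u")
    case True
    have "w - var j + var i = (u - var j + var i) + var k"
      unfolding uk using True
      by (intro poly_mapping_eqI) (auto simp: in_keys_iff lookup_add lookup_minus lookup_var)
    moreover have "u - var j + var i \<in> A" using stable_setD[OF assms uk(2) True] i by simp
    ultimately show ?thesis using uk(3) unfolding shadow_def by blast
  next
    case False
    then have "j = k" using j unfolding uk by (auto simp: keys_add_expo)
    then have "w - var j + var i = u + var i" unfolding uk by simp
    moreover have "i \<in> {1..n}" using uk(3) i \<open>j = k\<close> by simp
    ultimately show ?thesis using uk(2) unfolding shadow_def by blast
  qed
qed

lemma shadow_degree_monomials:
  "A \<subseteq> degree_monomials n d \<Longrightarrow> shadow n A \<subseteq> degree_monomials n (Suc d)"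
  unfolding shadow_def degree_monomials_def
  by (auto simp: monomials_add_iff var_in_monomials mdeg_add)

lemma finite_degree_monomials: "finite (degree_monomials n d)"
proof (induction d)
  case 0
  have "degree_monomials n 0 \<subseteq> {0}" unfolding degree_monomials_def by (auto simp: mdeg_eq_0_iff)
  then show ?case by (rule finite_subset) simp
next
  case (Suc d)
  have "degree_monomials n (Suc d) \<subseteq> (\<lambda>(u, k). u + var k) ` (degree_monomials n d \<times> {1..n})"
  proof
    fix u assume u: "u \<in> degree_monomials n (Suc d)"
    then have "u \<noteq> 0" by (auto simp: degree_monomials_def mdeg_def)
    then obtain k where k: "k \<in> Poly_Mapping.keys u" using keys_eq_empty[of u] by blast
    have eq: "u - var k + var k = u" using k by (rule minus_var_add_var)
    have "u - var k \<in> degree_monomials n d" "k \<in> {1..n}"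
      using u k monomials_add_iff[of "u - var k" "var k" n] mdeg_add[of "u - var k" "var k"]
      unfolding eq by (auto simp: degree_monomials_def monomials_def)
    then show "u \<in> (\<lambda>(u, k). u + var k) ` (degree_monomials n d \<times> {1..n})"
      using eq[symmetric] by (intro image_eqI[of _ _ "(u - var k, k)"]) auto
  qed
  then show ?case by (rule finite_subset) (simp add: Suc.IH)
qed

lemma max_var_eq_iff:
  assumes "u \<noteq> 0"
  shows "max_var u = i \<longleftrightarrow> i \<in> Poly_Mapping.keys u \<and> Poly_Mapping.keys u \<subseteq> {..i}"
  unfolding max_var_def using assms Max_eq_iff[of "Poly_Mapping.keys u" i] by auto

section \<open>Counting monomials by their last variable\<close>

text \<open>
  The monomials of \<open>A\<close> whose last variable is \<open>x\<^sub>i\<close>. For the monomial \<open>1\<close> the value of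
  \<^const>\<open>max_var\<close> is unspecified, so the counting lemmas require \<open>0 \<notin> A\<close>.
\<close>

definition layer :: "expo set \<Rightarrow> nat \<Rightarrow> expo set" where
  "layer A i = {u \<in> A. max_var u = i}"

lemma Int_monomials_eq_Union_layers:
  assumes "A \<subseteq> degree_monomials n d" "0 \<notin> A"
  shows "A \<inter> monomials i = (\<Union>q\<in>{1..i}. layer A q)"
proof
  show "A \<inter> monomials i \<subseteq> (\<Union>q\<in>{1..i}. layer A q)"
  proof
    fix u assume u: "u \<in> A \<inter> monomials i"
    then have "max_var u \<in> Poly_Mapping.keys u" using max_var_eq_iff[of u] assms(2) by blast
    then show "u \<in> (\<Union>q\<in>{1..i}. layer A q)" using u by (auto simp: layer_def monomials_def)
  qed
  show "(\<Union>q\<in>{1..i}. layer A q) \<subseteq> A \<inter> monomials i"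
  proof
    fix u assume "u \<in> (\<Union>q\<in>{1..i}. layer A q)"
    then have u: "u \<in> A" "max_var u \<le> i" by (auto simp: layer_def)
    then have "Poly_Mapping.keys u \<subseteq> {..max_var u}" using max_var_eq_iff[of u] assms(2) by blast
    moreover have "Poly_Mapping.keys u \<subseteq> {1..n}"
      using u(1) assms(1) by (auto simp: degree_monomials_def monomials_def)
    ultimately have "Poly_Mapping.keys u \<subseteq> {1..i}" using u(2) by fastforce
    then show "u \<in> A \<inter> monomials i" using u(1) by (simp add: monomials_def)
  qed
qed

lemma card_Int_monomials:
  assumes "A \<subseteq> degree_monomials n d" "0 \<notin> A"
  shows "card (A \<inter> monomials i) = (\<Sum>q=1..i. card (layer A q))"
proof -
  have "finite A" using assms(1) finite_degree_monomials finite_subset by blast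
  then show ?thesis unfolding Int_monomials_eq_Union_layers[OF assms]
    by (intro card_UN_disjoint) (auto simp: layer_def)
qed

text \<open>
  By stability, every product whose last variable is \<open>x\<^sub>i\<close> can be rewritten so that the factor \<open>x\<^sub>i\<close>
  is the one that was multiplied in.
\<close>

lemma layer_shadow:
  assumes A: "A \<subseteq> degree_monomials n d" "0 \<notin> A" "stable_set A" and i: "i \<in> {1..n}"
  shows "layer (shadow n A) i = (\<lambda>v. v + var i) ` (A \<inter> monomials i)"
proof
  show "layer (shadow n A) i \<subseteq> (\<lambda>v. v + var i) ` (A \<inter> monomials i)"
  proof
    fix w assume w: "w \<in> layer (shadow n A) i"
    then obtain u k where uk: "w = u + var k" "u \<in> A" "k \<in> {1..n}" "max_var w = i"
      unfolding layer_def shadow_def by blast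
    have "w \<noteq> 0" using uk(1) keys_add_expo[of u "var k"] keys_eq_empty[of w] by auto
    then have keys: "i \<in> Poly_Mapping.keys w" "Poly_Mapping.keys w \<subseteq> {..i}"
      using uk(4) max_var_eq_iff by blast+
    have "Poly_Mapping.keys u \<subseteq> {1..n}"
      using uk(2) A(1) by (auto simp: degree_monomials_def monomials_def)
    moreover have "Poly_Mapping.keys u \<subseteq> {..i}" and k: "k \<le> i"
      using keys(2) unfolding uk(1) by (simp_all add: keys_add_expo)
    ultimately have u: "u \<in> monomials i" by (fastforce simp: monomials_def)
    show "w \<in> (\<lambda>v. v + var i) ` (A \<inter> monomials i)"
    proof (cases "k = i")
      case True
      then show ?thesis using uk u by blast
    next
      case False
      have iu: "i \<in> Poly_Mapping.keys u" using keys(1) False unfolding uk(1) by (auto simp: keys_add_expo)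
      have "u - var i + var k \<in> A"
        using stable_setD[OF A(3) uk(2) iu] uk(3) k False by simp
      moreover have "u - var i + var k \<in> monomials i"
        using monomials_move[OF u iu] uk(3) k False by simp
      moreover have "w = (u - var i + var k) + var i"
        unfolding uk(1) by (subst minus_var_add_var[OF iu, symmetric]) (simp only: ac_simps)
      ultimately show ?thesis by blast
    qed
  qed
  show "(\<lambda>v. v + var i) ` (A \<inter> monomials i) \<subseteq> layer (shadow n A) i"
  proof clarify
    fix v assume v: "v \<in> A" "v \<in> monomials i"
    have keys: "i \<in> Poly_Mapping.keys (v + var i)" "Poly_Mapping.keys (v + var i) \<subseteq> {..i}"
      using v(2) by (auto simp: keys_add_expo monomials_def)
    then have "v + var i \<noteq> 0" by auto
    then have "max_var (v + var i) = i" using keys max_var_eq_iff by blast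
    then show "v + var i \<in> layer (shadow n A) i"
      using v(1) i unfolding layer_def shadow_def by blast
  qed
qed

lemma card_layer_shadow:
  assumes "A \<subseteq> degree_monomials n d" "0 \<notin> A" "stable_set A" "i \<in> {1..n}"
  shows "card (layer (shadow n A) i) = (\<Sum>q=1..i. card (layer A q))"
  unfolding layer_shadow[OF assms] card_Int_monomials[OF assms(1,2), symmetric]
  by (rule card_image) (auto intro: inj_onI)

section \<open>Lexsegments and the extension to the next degree\<close>

text \<open>
  The part of \<open>A\<close> in the first \<open>r\<close> variables is closed upwards, in the lexicographic order, among the
  monomials of degree \<open>d\<close> in these variables. Nothing is required of the remaining monomials of \<open>A\<close>.
\<close>

definition lexsegment :: "nat \<Rightarrow> nat \<Rightarrow> expo set \<Rightarrow> bool" where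
  "lexsegment r d A \<longleftrightarrow>
     (\<forall>u v. u \<in> degree_monomials r d \<longrightarrow> v \<in> A \<inter> monomials r \<longrightarrow> v < u \<longrightarrow> u \<in> A)"

lemma upper_subset_if_card_le:
  fixes A B :: "'a :: linorder set"
  assumes "A \<subseteq> S" "B \<subseteq> S" "finite S"
    and upA: "\<And>u v. v \<in> A \<Longrightarrow> u \<in> S \<Longrightarrow> v < u \<Longrightarrow> u \<in> A"
    and upB: "\<And>u v. v \<in> B \<Longrightarrow> u \<in> S \<Longrightarrow> v < u \<Longrightarrow> u \<in> B"
    and card: "card A \<le> card B"
  shows "A \<subseteq> B"
proof (rule ccontr)
  assume "\<not> A \<subseteq> B"
  then obtain a where a: "a \<in> A" "a \<notin> B" by blast
  have "B \<subseteq> A"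
  proof
    fix b assume b: "b \<in> B"
    then have "a < b" using upB[OF b, of a] a assms(1) by (metis linorder_neqE subsetD)
    then show "b \<in> A" using upA a(1) b assms(2) by blast
  qed
  moreover have "finite A" using assms finite_subset by blast
  ultimately have "A = B" using card card_seteq by metis
  with a show False by blast
qed

lemma move_greater:
  assumes "j \<in> Poly_Mapping.keys u" "i < j"
  shows "u < u - var j + (var i :: expo)"
  unfolding less_poly_mapping.rep_eq less_fun_def using assms
  by (intro exI[of _ i]) (auto simp: in_keys_iff lookup_add lookup_minus lookup_var)

text \<open>
  Since exchanges increase the order, adding the largest missing monomial of a stable set \<open>D\<close>
  preserves stability; hence all cardinalities between those of \<open>C\<close> and \<open>D\<close> are attained.
\<close>

lemma stable_extend:
  assumes "stable_set C" "stable_set D" "C \<subseteq> D" "finite D"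
    and "card C \<le> k" "k \<le> card D"
  shows "\<exists>E. stable_set E \<and> C \<subseteq> E \<and> E \<subseteq> D \<and> card E = k"
  using assms(5,6)
proof (induction k rule: dec_induct)
  case base
  then show ?case using assms by blast
next
  case (step k)
  then obtain E where E: "stable_set E" "C \<subseteq> E" "E \<subseteq> D" "card E = k" by auto
  have fin: "finite (D - E)" "finite E" using assms(4) E(3) finite_subset by auto
  have "D - E \<noteq> {}" using E step.prems by auto
  define u where "u = Max (D - E)"
  have u: "u \<in> D" "u \<notin> E" using Max_in[OF fin(1) \<open>D - E \<noteq> {}\<close>] unfolding u_def by auto
  have max: "v \<in> E" if "v \<in> D" "u < v" for v
    using that Max_ge[OF fin(1), of v] unfolding u_def by (meson DiffI leD)
  have "stable_set (insert u E)"
    unfolding stable_set_def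
  proof (intro ballI allI impI)
    fix w j i assume w: "w \<in> insert u E" and j: "j \<in> Poly_Mapping.keys w" and i: "1 \<le> i \<and> i < j"
    show "w - var j + var i \<in> insert u E"
    proof (cases "w = u")
      case True
      then have "u - var j + var i \<in> D" "u < u - var j + var i"
        using stable_setD[OF assms(2) u(1)] move_greater[of j u i] j i by auto
      then show ?thesis using max True by blast
    next
      case False
      then show ?thesis using w j i stable_setD[OF E(1)] by blast
    qed
  qed
  then show ?case using E u fin by (intro exI[of _ "insert u E"]) auto
qed

text \<open>
  The inductive step of the construction. The layers below \<open>n\<close> of the shadow of \<open>A\<close> and of \<open>B\<close> consist
  of the largest monomials with the given last variable, so the inequality between their sizes yields
  an inclusion.
  The shadow together with the part of \<open>B\<close> free of \<open>x\<^sub>n\<close> is then a stable set with the correct layers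
  below \<open>n\<close>; its layer \<open>n\<close> is filled up with monomials of \<open>B\<close>, of which there are enough.
\<close>

lemma extension_step:
  assumes n: "1 \<le> n"
    and A: "A \<subseteq> degree_monomials n d" "0 \<notin> A" "stable_set A" "lexsegment (n - 1) d A"
    and B: "B \<subseteq> degree_monomials n (Suc d)" "stable_set B" "lexsegment (n - 1) (Suc d) B"
    and le: "\<And>i. i \<in> {1..n} \<Longrightarrow> (\<Sum>q=1..i. card (layer A q)) \<le> card (layer B i)"
  shows "\<exists>A'. A' \<subseteq> degree_monomials n (Suc d) \<and> stable_set A' \<and> lexsegment (n - 1) (Suc d) A' \<and>
           shadow n A \<subseteq> A' \<and> (\<forall>i\<in>{1..n}. card (layer A' i) = card (layer B i))"
proof -
  have zero: "0 \<notin> degree_monomials n (Suc d)" by (simp add: degree_monomials_def mdeg_def)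
  have finB: "finite B" using B(1) finite_degree_monomials finite_subset by blast
  have sh: "shadow n A \<subseteq> degree_monomials n (Suc d)" using A(1) by (rule shadow_degree_monomials)
  have low: "layer (shadow n A) i \<subseteq> layer B i" if i: "i \<in> {1..n - 1}" for i
  proof (rule upper_subset_if_card_le)
    let ?S = "layer (degree_monomials n (Suc d)) i"
    show "layer (shadow n A) i \<subseteq> ?S" "layer B i \<subseteq> ?S" using sh B(1) by (auto simp: layer_def)
    show "finite ?S" using finite_degree_monomials by (simp add: layer_def)
    have i': "i \<in> {1..n}" using i by auto
    show "card (layer (shadow n A) i) \<le> card (layer B i)"
      using card_layer_shadow[OF A(1-3) i'] le[OF i'] by simp
    have S_mon: "w \<in> degree_monomials (n - 1) (Suc d) \<and> w \<in> monomials i \<and> i \<in> Poly_Mapping.keys w"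
      if "w \<in> ?S" for w
    proof -
      have w: "w \<in> degree_monomials n (Suc d)" "max_var w = i" using that by (auto simp: layer_def)
      have "w \<noteq> 0" using w(1) zero by auto
      then have "i \<in> Poly_Mapping.keys w" "Poly_Mapping.keys w \<subseteq> {..i}"
        using w(2) max_var_eq_iff by blast+
      with w(1) i show ?thesis by (fastforce simp: degree_monomials_def monomials_def)
    qed
    show "u \<in> layer B i" if "v \<in> layer B i" "u \<in> ?S" "v < u" for u v
    proof -
      have "v \<in> B \<inter> monomials (n - 1)"
        using that(1) S_mon[of v] B(1) by (auto simp: layer_def degree_monomials_def)
      then have "u \<in> B" using B(3) S_mon[OF that(2)] that(3) unfolding lexsegment_def by blast
      then show ?thesis using that(2) by (simp add: layer_def)
    qed
    show "u \<in> layer (shadow n A) i"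
      if vu: "v \<in> layer (shadow n A) i" "u \<in> ?S" "v < u" for u v
    proof -
      obtain v' where v': "v = v' + var i" "v' \<in> A" "v' \<in> monomials i"
        using vu(1) unfolding layer_shadow[OF A(1-3) i'] by blast
      define u' where "u' = u - var i"
      have u: "u = u' + var i"
        using minus_var_add_var[of i u] S_mon[OF vu(2)] by (simp add: u'_def)
      have "u' \<in> degree_monomials (n - 1) d" "u' \<in> monomials i"
        using S_mon[OF vu(2)] unfolding u by (auto simp: degree_monomials_def monomials_add_iff mdeg_add)
      moreover have "v' \<in> monomials (n - 1)" using v'(3) i by (auto simp: monomials_def)
      moreover have "v' < u'" using vu(3) unfolding v'(1) u by simp
      ultimately have "u' \<in> A \<inter> monomials i" using A(4) v'(2) unfolding lexsegment_def by blast
      then show ?thesis unfolding layer_shadow[OF A(1-3) i'] u by blast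
    qed
  qed
  \<comment> \<open>\<open>T\<close> is the part that the new set must have outside layer \<open>n\<close>, \<open>C\<close> and \<open>D\<close> are the bounds between
      which layer \<open>n\<close> is filled up.\<close>
  define T where "T = B \<inter> monomials (n - 1)"
  define C where "C = shadow n A \<union> T"
  define D where "D = C \<union> B"
  have stC: "stable_set C" unfolding C_def T_def
    by (intro stable_Un stable_shadow stable_Int stable_monomials A B)
  have stD: "stable_set D" unfolding D_def by (intro stable_Un stC B)
  have CD: "C \<subseteq> D" unfolding D_def by blast
  have Ddeg: "D \<subseteq> degree_monomials n (Suc d)" unfolding D_def C_def T_def using sh B(1) by blast
  have finD: "finite D" using Ddeg finite_degree_monomials finite_subset by blast
  have zD: "0 \<notin> D" using Ddeg zero by blast
  have monT: "w \<in> T" if "w \<in> D" "w \<in> monomials (n - 1)" for w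
  proof -
    have "w \<in> D \<inter> monomials (n - 1)" using that by blast
    then obtain q where q: "q \<in> {1..n - 1}" "w \<in> layer D q"
      unfolding Int_monomials_eq_Union_layers[OF Ddeg zD] by blast
    then have "w \<in> B" using low[OF q(1)] unfolding D_def C_def T_def by (auto simp: layer_def)
    then show ?thesis using that unfolding T_def by blast
  qed
  have layer_eq: "layer E i = layer B i" if E: "T \<subseteq> E" "E \<subseteq> D" and i: "i \<in> {1..n - 1}" for E i
  proof -
    have mon: "w \<in> monomials (n - 1)" if "w \<in> layer D i" for w
      using Int_monomials_eq_Union_layers[OF Ddeg zD, of "n - 1"] that i by blast
    show ?thesis
    proof
      show "layer E i \<subseteq> layer B i"
        using E(2) mon monT unfolding T_def by (auto simp: layer_def)
      show "layer B i \<subseteq> layer E i"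
        using E(1) mon unfolding T_def D_def by (auto simp: layer_def)
    qed
  qed
  \<comment> \<open>The cardinality of a set between \<open>T\<close> and \<open>D\<close> determines that of its layer \<open>n\<close>.\<close>
  have split: "card E = card T + card (layer E n)" if E: "T \<subseteq> E" "E \<subseteq> D" for E
  proof -
    have Edeg: "E \<subseteq> degree_monomials n (Suc d)" and zE: "0 \<notin> E" using E(2) Ddeg zD by auto
    have *: "card (E \<inter> monomials k) = (\<Sum>q=1..k. card (layer E q))" for k
      by (rule card_Int_monomials[OF Edeg zE])
    have "E \<inter> monomials n = E" using Edeg by (auto simp: degree_monomials_def)
    moreover have "E \<inter> monomials (n - 1) = T" using E monT unfolding T_def by blast
    moreover have "(\<Sum>q=1..n. card (layer E q)) = (\<Sum>q=1..n - 1. card (layer E q)) + card (layer E n)"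
      using n by (cases n) auto
    ultimately show ?thesis using *[of n] *[of "n - 1"] by simp
  qed
  have TC: "T \<subseteq> C" and TD: "T \<subseteq> D" unfolding C_def D_def by auto
  have layCn: "layer C n = layer (shadow n A) n"
  proof -
    have "max_var w \<noteq> n" if "w \<in> T" for w
    proof -
      have "w \<in> B \<inter> monomials (n - 1)" "B \<subseteq> degree_monomials n (Suc d)" "0 \<notin> B"
        using that B(1) zero unfolding T_def by auto
      then have "max_var w \<in> {1..n - 1}"
        using Int_monomials_eq_Union_layers[of B n "Suc d" "n - 1"] by (auto simp: layer_def)
      then show ?thesis using n by auto
    qed
    then show ?thesis unfolding C_def by (auto simp: layer_def)
  qed
  define k where "k = card T + card (layer B n)"
  have "card C \<le> k"
    using split[OF TC CD] le[of n] card_layer_shadow[OF A(1-3), of n] n layCn unfolding k_def by simp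
  moreover have "card (layer B n) \<le> card (layer D n)"
    using finD by (intro card_mono) (auto simp: layer_def D_def)
  then have "k \<le> card D" using split[OF TD] unfolding k_def by simp
  ultimately obtain E where E: "stable_set E" "C \<subseteq> E" "E \<subseteq> D" "card E = k"
    using stable_extend[OF stC stD CD finD] by blast
  have TE: "T \<subseteq> E" using TC E(2) by blast
  have "card (layer E i) = card (layer B i)" if "i \<in> {1..n}" for i
  proof (cases "i = n")
    case True
    then show ?thesis using split[OF TE E(3)] E(4) k_def by simp
  next
    case False
    then show ?thesis using layer_eq[OF TE E(3), of i] that by auto
  qed
  moreover have "lexsegment (n - 1) (Suc d) E"
    unfolding lexsegment_def
  proof (intro allI impI)
    fix u v assume u: "u \<in> degree_monomials (n - 1) (Suc d)" and v: "v \<in> E \<inter> monomials (n - 1)" and "v < u"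
    have "v \<in> T" using v E(3) monT by blast
    then have "u \<in> T"
      using B(3) u \<open>v < u\<close> unfolding lexsegment_def T_def degree_monomials_def by blast
    then show "u \<in> E" using TE by blast
  qed
  ultimately show ?thesis
    using E Ddeg unfolding C_def by (intro exI[of _ E]) auto
qed

section \<open>Monomial ideals\<close>

text \<open>
  The exponent vectors of the monomials in the ideal generated by the monomials in \<open>X\<close>.
\<close>

definition multiples :: "nat \<Rightarrow> expo set \<Rightarrow> expo set" where
  "multiples n X = {u + w |u w. u \<in> X \<and> w \<in> monomials n}"

lemma zero_in_monomials [simp]: "0 \<in> monomials n"
  by (simp add: monomials_def)

lemma subset_multiples: "X \<subseteq> multiples n X"
  unfolding multiples_def by (force intro: exI[of _ 0])

lemma multiples_subset_monomials: "X \<subseteq> monomials n \<Longrightarrow> multiples n X \<subseteq> monomials n"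
  unfolding multiples_def by (auto simp: monomials_add_iff)

lemma multiples_add:
  assumes "u \<in> multiples n X" "w \<in> monomials n"
  shows "u + w \<in> multiples n X"
proof -
  obtain x y where "u = x + y" "x \<in> X" "y \<in> monomials n" using assms(1) unfolding multiples_def by blast
  then have "u + w = x + (y + w)" "y + w \<in> monomials n"
    using assms(2) by (simp_all add: add.assoc monomials_add_iff)
  then show ?thesis using \<open>x \<in> X\<close> unfolding multiples_def by blast
qed

lemma keys_mon [simp]: "Poly_Mapping.keys (mon u :: 'k::field mpoly) = {u}"
  by (simp add: mon_def)

lemma carrier_poly_ring: "f \<in> carrier (poly_ring n) \<longleftrightarrow> Poly_Mapping.keys f \<subseteq> monomials n"
  by (simp add: poly_ring_def)

lemma ideal_supported:
  assumes "U \<subseteq> monomials n" and closed: "\<And>u w. u \<in> U \<Longrightarrow> w \<in> monomials n \<Longrightarrow> u + w \<in> U"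
  shows "ideal {f :: 'k::field mpoly. Poly_Mapping.keys f \<subseteq> U} (poly_ring n)"
proof -
  interpret cring "poly_ring n :: 'k mpoly ring" by (rule cring_poly_ring)
  let ?J = "{f :: 'k mpoly. Poly_Mapping.keys f \<subseteq> U}"
  have J: "x \<in> carrier (poly_ring n)" if "x \<in> ?J" for x
    using that assms(1) by (auto simp: carrier_poly_ring)
  have neg: "\<ominus>\<^bsub>poly_ring n\<^esub> x = - x" if "x \<in> ?J" for x
    using J[OF that] by (intro minus_equality) (auto simp: poly_ring_def)
  have "subgroup ?J (add_monoid (poly_ring n))"
  proof (rule subgroup.intro)
    show "?J \<subseteq> carrier (add_monoid (poly_ring n))" using J by auto
    show "x \<otimes>\<^bsub>add_monoid (poly_ring n)\<^esub> y \<in> ?J" if "x \<in> ?J" "y \<in> ?J" for x y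
      using that Poly_Mapping.keys_add[of x y] by (auto simp: poly_ring_def)
    show "\<one>\<^bsub>add_monoid (poly_ring n)\<^esub> \<in> ?J" by (simp add: poly_ring_def)
    show "inv\<^bsub>add_monoid (poly_ring n)\<^esub> x \<in> ?J" if "x \<in> ?J" for x
      using that neg[OF that] by (simp add: a_inv_def)
  qed
  moreover have mult: "x * a \<in> ?J" if "a \<in> ?J" "Poly_Mapping.keys x \<subseteq> monomials n" for a x
  proof -
    have "u + v \<in> U" if "u \<in> Poly_Mapping.keys x" "v \<in> Poly_Mapping.keys a" for u v
      using closed[of v u] that \<open>a \<in> ?J\<close> \<open>Poly_Mapping.keys x \<subseteq> _\<close> by (auto simp: add.commute)
    then show ?thesis using keys_mult[of x a] by blast
  qed
  ultimately show ?thesis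
    using ring_axioms mult
    by (intro idealI) (auto simp: poly_ring_def mult.commute[where 'a="'k mpoly"])
qed

lemma supported_in_ideal:
  fixes J :: "'k::field mpoly set"
  assumes "ideal J (poly_ring n)" "X \<subseteq> monomials n" "mon ` X \<subseteq> J"
    and "Poly_Mapping.keys f \<subseteq> multiples n X"
  shows "f \<in> J"
  using assms(4)
proof (induction "card (Poly_Mapping.keys f)" arbitrary: f)
  case 0
  interpret ideal J "poly_ring n" by fact
  from 0 have "f = 0" by simp
  then show ?case using additive_subgroup.zero_closed[OF is_additive_subgroup] by (simp add: poly_ring_def)
next
  case (Suc k)
  interpret ideal J "poly_ring n" by fact
  from Suc(2) obtain v where v: "v \<in> Poly_Mapping.keys f" by fastforce
  define c where "c = Poly_Mapping.lookup f v"
  define g where "g = f - Poly_Mapping.single v c"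
  have keys_g: "Poly_Mapping.keys g = Poly_Mapping.keys f - {v}"
    by (auto simp: g_def c_def in_keys_iff lookup_minus lookup_single when_def split: if_splits)
  have "g \<in> J"
    using Suc v keys_g by (intro Suc(1)) auto
  moreover have "Poly_Mapping.single v c \<in> J"
  proof -
    obtain u w where uw: "v = w + u" "u \<in> X" "w \<in> monomials n"
      using v Suc.prems unfolding multiples_def by (auto simp: add.commute)
    have "Poly_Mapping.single w c \<otimes>\<^bsub>poly_ring n\<^esub> mon u \<in> J"
      using uw assms(3) by (intro I_l_closed) (auto simp: carrier_poly_ring)
    then show ?thesis unfolding uw(1) by (simp add: poly_ring_def mon_def mult_single)
  qed
  ultimately have "g \<oplus>\<^bsub>poly_ring n\<^esub> Poly_Mapping.single v c \<in> J"
    by (rule additive_subgroup.a_closed[OF is_additive_subgroup])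
  then show ?case by (simp add: poly_ring_def g_def)
qed

lemma genideal_mon:
  assumes "X \<subseteq> monomials n"
  shows "genideal (poly_ring n) (mon ` X) = {f :: 'k::field mpoly. Poly_Mapping.keys f \<subseteq> multiples n X}"
proof -
  interpret cring "poly_ring n :: 'k mpoly ring" by (rule cring_poly_ring)
  have sub: "mon ` X \<subseteq> carrier (poly_ring n :: 'k mpoly ring)"
    using assms by (auto simp: carrier_poly_ring)
  show ?thesis
  proof
    show "genideal (poly_ring n) (mon ` X) \<subseteq> {f :: 'k mpoly. Poly_Mapping.keys f \<subseteq> multiples n X}"
      using subset_multiples[of X n]
      by (intro genideal_minimal ideal_supported multiples_subset_monomials assms multiples_add) auto
    show "{f :: 'k mpoly. Poly_Mapping.keys f \<subseteq> multiples n X} \<subseteq> genideal (poly_ring n) (mon ` X)"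
      using supported_in_ideal[OF genideal_ideal[OF sub] assms genideal_self[OF sub]] by blast
  qed
qed

lemma mon_in_genideal_iff:
  "X \<subseteq> monomials n \<Longrightarrow> (mon u :: 'k::field mpoly) \<in> genideal (poly_ring n) (mon ` X) \<longleftrightarrow> u \<in> multiples n X"
  by (simp add: genideal_mon)

lemma genideal_mon_minimal:
  fixes J :: "'k::field mpoly set"
  assumes "ideal J (poly_ring n)" "mon ` X \<subseteq> J"
  shows "genideal (poly_ring n) (mon ` X) \<subseteq> J"
proof -
  interpret cring "poly_ring n :: 'k mpoly ring" by (rule cring_poly_ring)
  show ?thesis using assms by (rule genideal_minimal)
qed

lemma genideal_subset_genideal_mon:
  fixes Y :: "'k::field mpoly set"
  assumes "A \<subseteq> monomials n" "\<And>f. f \<in> Y \<Longrightarrow> Poly_Mapping.keys f \<subseteq> A"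
  shows "genideal (poly_ring n) Y \<subseteq> genideal (poly_ring n) (mon ` A)"
proof -
  interpret cring "poly_ring n :: 'k mpoly ring" by (rule cring_poly_ring)
  have "mon ` A \<subseteq> carrier (poly_ring n :: 'k mpoly ring)"
    using assms(1) by (auto simp: carrier_poly_ring)
  moreover have "Y \<subseteq> genideal (poly_ring n) (mon ` A)"
    unfolding genideal_mon[OF assms(1)] using assms(2) subset_multiples[of A n] by blast
  ultimately show ?thesis by (intro genideal_minimal genideal_ideal)
qed

lemma ideal_genideal_mon:
  assumes "A \<subseteq> monomials n"
  shows "ideal (genideal (poly_ring n) (mon ` A) :: 'k::field mpoly set) (poly_ring n)"
proof -
  interpret cring "poly_ring n :: 'k mpoly ring" by (rule cring_poly_ring)
  show ?thesis using assms by (intro genideal_ideal) (auto simp: carrier_poly_ring)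
qed

text \<open>
  Any generating set of monomials must contain \<open>A\<close>: a generator dividing \<open>u \<in> A\<close> is itself divisible
  by an element of \<open>A\<close>, of the same degree as \<open>u\<close>.
\<close>

lemma min_gens_single_degree:
  assumes A: "A \<subseteq> degree_monomials n d"
  shows "min_gens n (genideal (poly_ring n) (mon ` A) :: 'k::field mpoly set) = A"
  unfolding min_gens_def
proof (rule the_equality)
  let ?I = "\<lambda>X. genideal (poly_ring n) (mon ` X) :: 'k mpoly set"
  have Am: "A \<subseteq> monomials n" using A by (auto simp: degree_monomials_def)
  have mult_eq: "multiples n X = multiples n Y"
    if "?I X = ?I Y" "X \<subseteq> monomials n" "Y \<subseteq> monomials n" for X Y
    using that mon_in_genideal_iff[where 'k='k] by blast
  have contains: "A \<subseteq> G" if G: "G \<subseteq> monomials n" "?I A = ?I G" for G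
  proof
    fix u assume u: "u \<in> A"
    have eq: "multiples n A = multiples n G" using mult_eq G Am by blast
    obtain g w where g: "u = g + w" "g \<in> G"
      using u subset_multiples[of A n] unfolding eq by (auto simp: multiples_def)
    obtain a w' where a: "g = a + w'" "a \<in> A"
      using g(2) subset_multiples[of G n] unfolding eq[symmetric] by (auto simp: multiples_def)
    have "mdeg u = d" "mdeg a = d" using u a(2) A by (auto simp: degree_monomials_def)
    then have "w = 0" using g(1) a(1) by (simp add: mdeg_add mdeg_eq_0_iff)
    then show "u \<in> G" using g by simp
  qed
  show "A \<subseteq> monomials n \<and> ?I A = ?I A \<and> (\<forall>H. H \<subset> A \<longrightarrow> ?I A \<noteq> ?I H)"
    using Am contains by blast
  show "G = A" if "G \<subseteq> monomials n \<and> ?I A = ?I G \<and> (\<forall>H. H \<subset> G \<longrightarrow> ?I A \<noteq> ?I H)" for G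
    using contains[of G] that by blast
qed

lemma num_gens_single_degree:
  assumes "A \<subseteq> degree_monomials n d" "0 \<notin> A"
  shows "num_gens n (genideal (poly_ring n) (mon ` A) :: 'k::field mpoly set) i = card (layer A i)"
proof -
  have "{u \<in> A. u \<noteq> 0 \<and> max_var u = i} = layer A i" using assms(2) by (auto simp: layer_def)
  then show ?thesis unfolding num_gens_def min_gens_single_degree[OF assms(1)] by simp
qed

text \<open>
  The degree \<open>j\<close> monomials \<open>A\<close> of such an ideal \<open>B\<close> are its minimal generators. The hypothesis on degree
  \<open>j + 1\<close> is needed only for monomials divisible by \<open>x\<^bsub>n-1\<^esub>\<close>: by stability, \<open>u\<close> in
  \<open>K[x\<^sub>1,\<dots>,x\<^bsub>n-1\<^esub>]\<close> lies in \<open>A\<close> if and only if \<open>x\<^bsub>n-1\<^esub>u\<close> lies in \<open>B\<close>, and the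
  multiplication preserves the order.
\<close>

lemma generators_of_stable_ideal:
  fixes B :: "'k::field mpoly set"
  assumes n: "1 \<le> n" and j: "1 \<le> j"
    and B: "strongly_stable n B" "generated_in_degree n j B"
    and lex: "piecewise_lexsegment (n - 1) (j + 1) (B \<inter> graded_component (n - 1) (j + 1))"
  shows "\<exists>A\<subseteq>degree_monomials n j. stable_set A \<and> lexsegment (n - 1) j A \<and>
           (\<forall>i. num_gens n B i = card (layer A i))"
proof (intro exI conjI allI)
  define A where "A = {u \<in> degree_monomials n j. (mon u :: 'k mpoly) \<in> B}"
  have Am: "A \<subseteq> monomials n" by (auto simp: A_def degree_monomials_def)
  obtain X where X: "X \<subseteq> monomials n" "B = genideal (poly_ring n) (mon ` X)"
    and idB: "ideal B (poly_ring n)"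
    using B(1) unfolding strongly_stable_def monomial_ideal_def by blast
  obtain Y where Y: "Y \<subseteq> graded_component n j" "B = genideal (poly_ring n) Y"
    using B(2) unfolding generated_in_degree_def by blast
  have BA: "B = genideal (poly_ring n) (mon ` A)"
  proof
    have "Poly_Mapping.keys f \<subseteq> A" if f: "f \<in> Y" for f
    proof -
      have "f \<in> B" unfolding Y(2) genideal_def using f by blast
      then have "Poly_Mapping.keys f \<subseteq> multiples n X" unfolding X(2) genideal_mon[OF X(1)] by simp
      then have "(mon u :: 'k mpoly) \<in> B" if "u \<in> Poly_Mapping.keys f" for u
        using that unfolding X(2) mon_in_genideal_iff[OF X(1)] by blast
      moreover have "Poly_Mapping.keys f \<subseteq> degree_monomials n j"
        using f Y(1) by (auto simp: graded_component_def carrier_poly_ring degree_monomials_def)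
      ultimately show ?thesis unfolding A_def by blast
    qed
    then show "B \<subseteq> genideal (poly_ring n) (mon ` A)"
      unfolding Y(2) by (rule genideal_subset_genideal_mon[OF Am])
    show "genideal (poly_ring n) (mon ` A) \<subseteq> B"
      by (rule genideal_mon_minimal[OF idB]) (auto simp: A_def)
  qed
  show sub: "A \<subseteq> degree_monomials n j" by (auto simp: A_def)
  then have zA: "0 \<notin> A" using j by (auto simp: degree_monomials_def mdeg_def)
  show "num_gens n B i = card (layer A i)" for i
    unfolding BA by (rule num_gens_single_degree[OF sub zA])
  show st: "stable_set A"
    unfolding stable_set_def
  proof (intro ballI allI impI)
    fix u k i assume u: "u \<in> A" and k: "k \<in> Poly_Mapping.keys u" and i: "1 \<le> i \<and> i < k"
    have "u - var k + var i \<in> degree_monomials n j"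
      using stable_setD[OF stable_degree_monomials _ k] u sub i by blast
    moreover have "mon (u - var k + var i) \<in> B"
      using B(1) u k i Am unfolding strongly_stable_def A_def var_def by blast
    ultimately show "u - var k + var i \<in> A" unfolding A_def by blast
  qed
  show "lexsegment (n - 1) j A"
    unfolding lexsegment_def
  proof (intro allI impI)
    fix u v assume u: "u \<in> degree_monomials (n - 1) j" and v: "v \<in> A \<inter> monomials (n - 1)" and vu: "v < u"
    have n1: "n - 1 \<in> {1..n - 1}"
    proof (rule ccontr)
      assume "n - 1 \<notin> {1..n - 1}"
      then have "n - 1 = 0" by auto
      then have "u = 0" using u by (auto simp: degree_monomials_def monomials_def)
      then show False using u j by (auto simp: degree_monomials_def mdeg_def)
    qed
    let ?x = "var (n - 1)"
    have max: "w + ?x \<noteq> 0 \<and> max_var (w + ?x) = n - 1 \<and> w + ?x \<in> monomials (n - 1)"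
      if "w \<in> monomials (n - 1)" for w
    proof -
      have keys: "n - 1 \<in> Poly_Mapping.keys (w + ?x)" "Poly_Mapping.keys (w + ?x) \<subseteq> {..n - 1}"
        using that by (auto simp: keys_add_expo monomials_def)
      from keys(1) have "w + ?x \<noteq> 0" by auto
      moreover from this keys have "max_var (w + ?x) = n - 1" by (simp add: max_var_eq_iff)
      moreover have "w + ?x \<in> monomials (n - 1)"
        using that var_in_monomials[OF n1] by (simp add: monomials_add_iff)
      ultimately show ?thesis by blast
    qed
    have vA: "v \<in> A" and vm: "v \<in> monomials (n - 1)" and um: "u \<in> monomials (n - 1)"
      and deg: "mdeg v = j" "mdeg u = j"
      using u v sub by (auto simp: degree_monomials_def)
    have "v + ?x \<in> multiples n A"
      using vA var_in_monomials[of "n - 1" n] n1 unfolding multiples_def by auto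
    then have "(mon (v + ?x) :: 'k mpoly) \<in> B" unfolding BA mon_in_genideal_iff[OF Am] .
    then have "mon (v + ?x) \<in> B \<inter> graded_component (n - 1) (j + 1)"
      using max[OF vm] deg by (simp add: graded_component_def carrier_poly_ring mdeg_add)
    moreover have "v + ?x < u + ?x" using vu by simp
    moreover have "mdeg (v + ?x) = j + 1" "mdeg (u + ?x) = j + 1" using deg by (simp_all add: mdeg_add)
    moreover note conjunct2[OF lex[unfolded piecewise_lexsegment_def], rule_format,
        OF n1, of "u + ?x" "v + ?x"]
    ultimately have "(mon (u + ?x) :: 'k mpoly) \<in> B"
      using max[OF vm] max[OF um] by blast
    then have "u + ?x \<in> multiples n A" unfolding BA mon_in_genideal_iff[OF Am] .
    then obtain a w where a: "u + ?x = a + w" "a \<in> A" "w \<in> monomials n" by (auto simp: multiples_def)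
    have "mdeg w = 1"
      using arg_cong[OF a(1), of mdeg] deg a(2) sub by (auto simp: mdeg_add degree_monomials_def)
    have "u + ?x \<in> shadow n A"
    proof -
      have "w \<noteq> 0" using \<open>mdeg w = 1\<close> by (auto simp: mdeg_def)
      then obtain k where k: "k \<in> Poly_Mapping.keys w" using keys_eq_empty[of w] by blast
      have eq: "w - var k + var k = w" using k by (rule minus_var_add_var)
      then have "w - var k = 0"
        using mdeg_add[of "w - var k" "var k"] \<open>mdeg w = 1\<close> by (simp add: mdeg_eq_0_iff)
      then have "w = var k" using eq by simp
      then show ?thesis using a k unfolding shadow_def monomials_def by blast
    qed
    then have "u + ?x \<in> layer (shadow n A) (n - 1)" using max[OF um] by (simp add: layer_def)
    then have "u + ?x \<in> (\<lambda>v. v + ?x) ` (A \<inter> monomials (n - 1))"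
      using layer_shadow[OF sub zA st, of "n - 1"] n1 by simp
    then show "u \<in> A" by auto
  qed
qed

text \<open>
  Stable sets in the single degrees, each containing the shadow of its predecessor, are the sets of
  degree \<open>j\<close> monomials of one strongly stable ideal.
\<close>

lemma ideal_of_sequence:
  assumes A: "\<And>j. A j \<subseteq> degree_monomials n j" "\<And>j. stable_set (A j)" "\<And>j. shadow n (A j) \<subseteq> A (Suc j)"
  defines "I \<equiv> genideal (poly_ring n) (mon ` (\<Union>j. A j)) :: 'k::field mpoly set"
  shows "strongly_stable n I" "1 \<le> j \<Longrightarrow> gen_matrix n I i j = card (layer (A j) i)"
proof -
  let ?U = "\<Union>j. A j"
  have "A j \<subseteq> monomials n" for j using A(1)[of j] by (auto simp: degree_monomials_def)
  then have Um: "?U \<subseteq> monomials n" by (rule UN_least)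
  have closed: "u + w \<in> ?U" if "u \<in> ?U" "w \<in> monomials n" for u w
    using that(2)
  proof (induction "mdeg w" arbitrary: w)
    case 0
    then have "w = 0" by (simp add: mdeg_eq_0_iff)
    then show ?case using that(1) by simp
  next
    case (Suc d)
    then have "w \<noteq> 0" by (auto simp: mdeg_def)
    then obtain k where k: "k \<in> Poly_Mapping.keys w" using keys_eq_empty[of w] by blast
    have eq: "w - var k + var k = w" using k by (rule minus_var_add_var)
    have "w - var k \<in> monomials n" using Suc.prems monomials_add_iff[of "w - var k" "var k" n] unfolding eq by simp
    moreover have "d = mdeg (w - var k)" using Suc(2) mdeg_add[of "w - var k" "var k"] unfolding eq by simp
    ultimately have "u + (w - var k) \<in> ?U" by (intro Suc(1))
    then obtain j where "u + (w - var k) \<in> A j" by blast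
    then have "u + (w - var k) + var k \<in> shadow n (A j)"
      using k Suc.prems unfolding shadow_def monomials_def by blast
    then have "u + (w - var k) + var k \<in> A (Suc j)" by (rule subsetD[OF A(3)])
    then show ?case by (simp only: add.assoc eq) (rule UN_I[OF UNIV_I])
  qed
  have mult: "multiples n ?U = ?U"
  proof
    show "multiples n ?U \<subseteq> ?U"
    proof
      fix v assume "v \<in> multiples n ?U"
      then obtain u w where "v = u + w" "u \<in> ?U" "w \<in> monomials n" unfolding multiples_def by blast
      then show "v \<in> ?U" using closed by simp
    qed
  qed (rule subset_multiples)
  have deg: "mdeg u = j" if "u \<in> A j" for u j
    using that A(1)[of j] by (auto simp: degree_monomials_def)
  have memI: "(mon u :: 'k mpoly) \<in> I \<longleftrightarrow> u \<in> ?U" for u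
    unfolding I_def mon_in_genideal_iff[OF Um] mult ..
  show "strongly_stable n I"
    unfolding strongly_stable_def monomial_ideal_def
  proof (intro conjI ballI allI impI)
    show "ideal I (poly_ring n)" unfolding I_def by (rule ideal_genideal_mon[OF Um])
    show "\<exists>X\<subseteq>monomials n. I = genideal (poly_ring n) (mon ` X)" using Um unfolding I_def by blast
    fix u j i assume "mon u \<in> I" and ji: "j \<in> Poly_Mapping.keys u" "1 \<le> i \<and> i < j"
    then obtain l where "u \<in> A l" unfolding memI by blast
    then have "u - var j + var i \<in> A l" using stable_setD[OF A(2) _ ji(1)] ji(2) by simp
    then show "mon (u - Poly_Mapping.single j 1 + Poly_Mapping.single i 1) \<in> I"
      unfolding memI var_def by blast
  qed
  show "gen_matrix n I i j = card (layer (A j) i)" if j: "1 \<le> j"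
  proof -
    have Ajm: "A j \<subseteq> monomials n" using Um by blast
    have Aj: "A j = {u \<in> monomials n. u \<in> ?U \<and> mdeg u = j}"
    proof
      show "A j \<subseteq> {u \<in> monomials n. u \<in> ?U \<and> mdeg u = j}" using deg Ajm by auto
      show "{u \<in> monomials n. u \<in> ?U \<and> mdeg u = j} \<subseteq> A j" using deg by blast
    qed
    have "Poly_Mapping.keys f \<subseteq> ?U \<and> Poly_Mapping.keys f \<subseteq> monomials n \<and>
        (\<forall>u\<in>Poly_Mapping.keys f. mdeg u = j) \<longleftrightarrow> Poly_Mapping.keys f \<subseteq> A j" for f :: "'k mpoly"
      unfolding Aj by blast
    then have keys: "f \<in> I \<inter> graded_component n j \<longleftrightarrow> Poly_Mapping.keys f \<subseteq> A j" for f :: "'k mpoly"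
      unfolding I_def genideal_mon[OF Um] mult graded_component_def
      by (simp add: carrier_poly_ring)
    have "degree_part_ideal n I j = genideal (poly_ring n) (mon ` A j)"
    proof
      show "degree_part_ideal n I j \<subseteq> genideal (poly_ring n) (mon ` A j)"
        unfolding degree_part_ideal_def by (rule genideal_subset_genideal_mon[OF Ajm]) (simp only: keys)
      have "mon ` A j \<subseteq> I \<inter> graded_component n j"
      proof
        fix f :: "'k mpoly" assume "f \<in> mon ` A j"
        then show "f \<in> I \<inter> graded_component n j" unfolding keys by auto
      qed
      then show "genideal (poly_ring n) (mon ` A j) \<subseteq> degree_part_ideal n I j"
        unfolding degree_part_ideal_def genideal_def by (intro Inter_anti_mono) blast
    qed
    moreover have "0 \<notin> A j" using deg[of 0 j] j by (auto simp: mdeg_def)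
    ultimately show ?thesis unfolding gen_matrix_def by (simp add: num_gens_single_degree[OF A(1)])
  qed
qed

section \<open>Existence of an ideal with a given matrix of generators\<close>

theorem proposition2p9:
  fixes n :: nat and \<mu> :: "nat \<Rightarrow> nat \<Rightarrow> nat"
  assumes n_pos: "1 \<le> n"
    and row_zero: "\<And>i. i \<in> {1..n} \<Longrightarrow> \<mu> i 0 = 0"
    and cond1: "\<And>j. 1 \<le> j \<Longrightarrow> \<exists>i\<in>{1..n}. \<mu> i j \<noteq> 0 \<Longrightarrow>
                  O_sequence n (\<lambda>i. \<mu> i j) \<and> (2 \<le> n \<longrightarrow> \<mu> 2 j \<le> j)"
    and cond2: "\<And>i j. i \<in> {1..n} \<Longrightarrow> 1 \<le> j \<Longrightarrow> (\<Sum>q=1..i. \<mu> q (j - 1)) \<le> \<mu> i j"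
    and cond3: "\<And>m :: nat.
                  (\<forall>h>m. \<forall>i\<in>{1..n}. \<mu> i h = (\<Sum>q=1..i. \<mu> q (h - 1))) \<Longrightarrow>
                  (\<forall>m'. (\<forall>h>m'. \<forall>i\<in>{1..n}. \<mu> i h = (\<Sum>q=1..i. \<mu> q (h - 1))) \<longrightarrow> m \<le> m') \<Longrightarrow>
                  (\<forall>j\<in>{1..m}. \<exists>B :: 'k::field mpoly set.
                     strongly_stable n B \<and> generated_in_degree n j B \<and>
                     (\<forall>i\<in>{1..n}. num_gens n B i = \<mu> i j) \<and>
                     piecewise_lexsegment (n - 1) (j + 1)
                       (B \<inter> graded_component (n - 1) (j + 1)))"
  shows "\<exists>I :: 'k::field mpoly set.
           strongly_stable n I \<and> (\<forall>i\<in>{1..n}. \<forall>j\<ge>1. gen_matrix n I i j = \<mu> i j)"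
proof -
  let ?rec = "\<lambda>m. \<forall>h>m. \<forall>i\<in>{1..n}. \<mu> i h = (\<Sum>q=1..i. \<mu> q (h - 1))"
  define m where "m = (LEAST m. ?rec m)"
  have rec: "?rec m"
    unfolding m_def using eventually_recursive[OF cond1 cond2] by (rule LeastI_ex)
  have least: "\<forall>m'. ?rec m' \<longrightarrow> m \<le> m'"
    using Least_le[of ?rec] unfolding m_def by blast
  have B: "\<exists>B\<subseteq>degree_monomials n j. stable_set B \<and> lexsegment (n - 1) j B \<and>
      (\<forall>i\<in>{1..n}. card (layer B i) = \<mu> i j)" if j: "j \<in> {1..m}" for j
  proof -
    obtain J :: "'k mpoly set" where J: "strongly_stable n J" "generated_in_degree n j J"
      "\<forall>i\<in>{1..n}. num_gens n J i = \<mu> i j"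
      "piecewise_lexsegment (n - 1) (j + 1) (J \<inter> graded_component (n - 1) (j + 1))"
      using bspec[OF cond3[OF rec least] j] by blast
    have "1 \<le> j" using j by simp
    from generators_of_stable_ideal[OF n_pos this J(1,2,4)] J(3) show ?thesis by metis
  qed
  let ?P = "\<lambda>j A. A \<subseteq> degree_monomials n j \<and> 0 \<notin> A \<and> stable_set A \<and>
      (j \<le> m \<longrightarrow> lexsegment (n - 1) j A) \<and> (\<forall>i\<in>{1..n}. card (layer A i) = \<mu> i j)"
  have "\<exists>A. \<forall>j. ?P j (A j) \<and> shadow n (A j) \<subseteq> A (Suc j)"
  proof (rule dependent_nat_choice)
    have "?P 0 {}" using row_zero by (simp add: stable_set_def lexsegment_def layer_def)
    then show "\<exists>A. ?P 0 A" by blast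
    fix A j assume A: "?P j A"
    then have lay: "(\<Sum>q=1..i. card (layer A q)) = (\<Sum>q=1..i. \<mu> q j)" if "i \<in> {1..n}" for i
      using that by (intro sum.cong) auto
    have zero: "0 \<notin> A'" if "A' \<subseteq> degree_monomials n (Suc j)" for A'
      using that by (auto simp: degree_monomials_def mdeg_def)
    show "\<exists>A'. ?P (Suc j) A' \<and> shadow n A \<subseteq> A'"
    proof (cases "Suc j \<le> m")
      case True
      then obtain B where B': "B \<subseteq> degree_monomials n (Suc j)" "stable_set B"
        "lexsegment (n - 1) (Suc j) B" "\<forall>i\<in>{1..n}. card (layer B i) = \<mu> i (Suc j)"
        using B[of "Suc j"] by auto
      have "(\<Sum>q=1..i. card (layer A q)) \<le> card (layer B i)" if "i \<in> {1..n}" for i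
        using cond2[OF that, of "Suc j"] B'(4) lay[OF that] that by simp
      moreover have "A \<subseteq> degree_monomials n j" "0 \<notin> A" "stable_set A" "lexsegment (n - 1) j A"
        using A True by auto
      ultimately obtain A' where "A' \<subseteq> degree_monomials n (Suc j)" "stable_set A'"
        "lexsegment (n - 1) (Suc j) A'" "shadow n A \<subseteq> A'"
        "\<forall>i\<in>{1..n}. card (layer A' i) = card (layer B i)"
        using extension_step[OF n_pos _ _ _ _ B'(1-3), of A] by blast
      then show ?thesis using B'(4) zero by (intro exI[of _ A']) auto
    next
      case False
      have "card (layer (shadow n A) i) = \<mu> i (Suc j)" if "i \<in> {1..n}" for i
        using card_layer_shadow[OF _ _ _ that, of A j] A lay[OF that] rec False that by auto
      then show ?thesis
        using A False shadow_degree_monomials[of A n j] stable_shadow[of A n] zero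
        by (intro exI[of _ "shadow n A"]) auto
    qed
  qed
  then obtain A where A: "\<And>j. ?P j (A j)" "\<And>j. shadow n (A j) \<subseteq> A (Suc j)" by blast
  from A(1) have sub: "\<And>j. A j \<subseteq> degree_monomials n j" and st: "\<And>j. stable_set (A j)"
    and num: "\<And>i j. i \<in> {1..n} \<Longrightarrow> card (layer (A j) i) = \<mu> i j" by auto
  note ideal = ideal_of_sequence[of A n, OF sub st A(2), where 'k='k]
  show ?thesis
    using ideal(1)
  proof (intro exI conjI ballI allI impI)
    fix i j :: nat assume "i \<in> {1..n}" "1 \<le> j"
    then show "gen_matrix n (genideal (poly_ring n) (mon ` (\<Union>j. A j)) :: 'k mpoly set) i j = \<mu> i j"
      using ideal(2) num by simp
  qed
qed

end
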